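(* Let $0<r<1$, let $$\varphi(z)=\frac{z+r}{1+rz},\qquad z\in\mathbb{D},$$ (a hyperbolic automorphism of the open unit disk $\mathbb{D}$), and let $C_\varphi f=f\circ\varphi$ be the composition operator on the Bergman space $L^2_a$. Then the set of extended eigenvalues of $C_\varphi$ is the unit circle: $$\mathrm{Ext}(C_\varphi)=\mathbb{T}=\{\lambda\in\mathbb{C}:|\lambda|=1\}.$$
   Context: The Bergman space $L^2_a$ is the Hilbert space of holomorphic functions $f$ on the open unit disk $\mathbb{D}$ with $\|f\|^2=\frac{1}{\pi}\int_{\mathbb{D}}|f(z)|^2\,dA(z)<\infty$, where $dA$ is Lebesgue area measure. For a bounded linear operator $A$ on a complex Hilbert space $H$, a scalar $\lambda\in\mathbb{C}$ is an extended eigenvalue of $A$ if there is a nonzero bounded linear operator $X$ on $H$ with $AX=\lambda XA$; $\mathrm{Ext}(A)$ denotes the set of all extended eigenvalues of $A$. *)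

theory Defs
  imports "HOL-Complex_Analysis.Complex_Analysis"
begin

section \<open>Extended eigenvalues of operators\<close>

class complex_normed_vector = real_normed_vector +
  fixes scaleC :: "complex \<Rightarrow> 'a \<Rightarrow> 'a" (infixr "*\<^sub>C" 75)
  assumes scaleC_add_right: "a *\<^sub>C (x + y) = a *\<^sub>C x + a *\<^sub>C y"
    and scaleC_add_left: "(a + b) *\<^sub>C x = a *\<^sub>C x + b *\<^sub>C x"
    and scaleC_scaleC: "a *\<^sub>C b *\<^sub>C x = (a * b) *\<^sub>C x"
    and scaleC_of_real: "of_real r *\<^sub>C x = r *\<^sub>R x"
    and norm_scaleC: "norm (a *\<^sub>C x) = cmod a * norm x"

definition bounded_clinear ::
  "('a::complex_normed_vector \<Rightarrow> 'b::complex_normed_vector) \<Rightarrow> bool" where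
  "bounded_clinear T \<longleftrightarrow> bounded_linear T \<and> (\<forall>c x. T (c *\<^sub>C x) = c *\<^sub>C T x)"

text \<open>The notion is used for bounded operators on complex Hilbert spaces; inner product and
  completeness do not enter it, so it is stated for complex normed spaces.\<close>

definition ext_eigenvalues :: "('a::complex_normed_vector \<Rightarrow> 'a) \<Rightarrow> complex set" where
  "ext_eigenvalues A =
     {\<mu>. \<exists>X. bounded_clinear X \<and> X \<noteq> (\<lambda>x. 0) \<and> (\<forall>x. A (X x) = \<mu> *\<^sub>C X (A x))}"

section \<open>The Bergman space of the unit disk\<close>

text \<open>A function on the disk is represented by its extension by zero to the plane, so that
  equality in the type is equality of functions on the disk.\<close>

definition bergman_functions :: "(complex \<Rightarrow> complex) set" where
  "bergman_functions =
     {f. f holomorphic_on ball 0 1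
         \<and> set_integrable lborel (ball 0 1) (\<lambda>z. (cmod (f z))\<^sup>2)
         \<and> (\<forall>z. z \<notin> ball 0 1 \<longrightarrow> f z = 0)}"

lemma bergman_functions_inner_integrable:
  assumes f: "f \<in> bergman_functions" and g: "g \<in> bergman_functions"
  shows "set_integrable lborel (ball 0 1) (\<lambda>z. f z \<bullet> g z)"
proof -
  have m: "(\<lambda>z. indicator (ball 0 1) z *\<^sub>R (f z \<bullet> g z)) \<in> borel_measurable lborel"
  proof -
    have "continuous_on (ball 0 1) (\<lambda>z. f z \<bullet> g z)"
      using f g unfolding bergman_functions_def
      by (auto intro!: continuous_intros holomorphic_on_imp_continuous_on)
    then show ?thesis
      unfolding measurable_lborel2
      by (intro borel_measurable_continuous_on_indicator borel_open open_ball)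
  qed
  have "set_integrable lborel (ball 0 1) (\<lambda>z. (cmod (f z))\<^sup>2 + (cmod (g z))\<^sup>2)"
    using f g by (auto simp: bergman_functions_def)
  then show ?thesis
    unfolding set_integrable_def
  proof (rule Bochner_Integration.integrable_bound[OF _ m], intro AE_I2)
    fix z
    have "\<bar>f z \<bullet> g z\<bar> \<le> cmod (f z) * cmod (g z)"
      by (rule Cauchy_Schwarz_ineq2)
    also have "\<dots> \<le> (cmod (f z))\<^sup>2 + (cmod (g z))\<^sup>2"
      using sum_squares_bound[of "cmod (f z)" "cmod (g z)"]
        mult_nonneg_nonneg[OF norm_ge_zero norm_ge_zero, of "f z" "g z"] by linarith
    finally show "norm (indicator (ball 0 1) z *\<^sub>R (f z \<bullet> g z))
        \<le> norm (indicator (ball 0 1) z *\<^sub>R ((cmod (f z))\<^sup>2 + (cmod (g z))\<^sup>2))"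
      by (simp add: indicator_def)
  qed
qed

lemma bergman_functions_zero: "(\<lambda>z. 0) \<in> bergman_functions"
  by (simp add: bergman_functions_def set_integrable_def)

lemma bergman_functions_add:
  assumes f: "f \<in> bergman_functions" and g: "g \<in> bergman_functions"
  shows "(\<lambda>z. f z + g z) \<in> bergman_functions"
proof -
  have "set_integrable lborel (ball 0 1) (\<lambda>z. (cmod (f z))\<^sup>2 + 2 * (f z \<bullet> g z) + (cmod (g z))\<^sup>2)"
    using f g bergman_functions_inner_integrable[OF f g] by (auto simp: bergman_functions_def)
  moreover have "(cmod (f z + g z))\<^sup>2 = (cmod (f z))\<^sup>2 + 2 * (f z \<bullet> g z) + (cmod (g z))\<^sup>2" for z
    by (simp add: power2_norm_eq_inner inner_add_left inner_add_right inner_commute)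
  ultimately show ?thesis
    using f g by (auto simp: bergman_functions_def intro!: holomorphic_intros)
qed

lemma bergman_functions_scale:
  assumes f: "f \<in> bergman_functions"
  shows "(\<lambda>z. c * f z) \<in> bergman_functions"
  using f by (auto simp: bergman_functions_def norm_mult power_mult_distrib
      intro!: holomorphic_intros)

typedef bergman = bergman_functions
  using bergman_functions_zero by blast

setup_lifting type_definition_bergman

instantiation bergman :: real_vector
begin
lift_definition zero_bergman :: bergman is "\<lambda>z. 0"
  by (rule bergman_functions_zero)
lift_definition plus_bergman :: "bergman \<Rightarrow> bergman \<Rightarrow> bergman" is "\<lambda>f g z. f z + g z"
  by (rule bergman_functions_add)
lift_definition uminus_bergman :: "bergman \<Rightarrow> bergman" is "\<lambda>f z. - f z"
  using bergman_functions_scale[of _ "-1"] by simp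
lift_definition minus_bergman :: "bergman \<Rightarrow> bergman \<Rightarrow> bergman" is "\<lambda>f g z. f z - g z"
  subgoal for f g using bergman_functions_add[OF _ bergman_functions_scale[of _ "-1"], of f g] by simp
  done
lift_definition scaleR_bergman :: "real \<Rightarrow> bergman \<Rightarrow> bergman" is "\<lambda>r f z. of_real r * f z"
  by (rule bergman_functions_scale)
instance
  by standard (transfer; simp add: algebra_simps fun_eq_iff)+
end

text \<open>On the complex plane \<^term>\<open>u \<bullet> v\<close> is the real part of \<^term>\<open>u * cnj v\<close>, so this is the
  real part of the complex inner product of the Bergman space and induces the Bergman norm.\<close>

instantiation bergman :: real_inner
begin
lift_definition inner_bergman :: "bergman \<Rightarrow> bergman \<Rightarrow> real" is
  "\<lambda>f g. 1 / pi * (LINT z:ball 0 1|lborel. f z \<bullet> g z)" .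
definition norm_bergman :: "bergman \<Rightarrow> real" where
  "norm_bergman f = sqrt (inner f f)"
definition sgn_bergman :: "bergman \<Rightarrow> bergman" where
  "sgn_bergman f = f /\<^sub>R norm f"
definition dist_bergman :: "bergman \<Rightarrow> bergman \<Rightarrow> real" where
  "dist_bergman f g = norm (f - g)"
definition uniformity_bergman :: "(bergman \<times> bergman) filter" where
  "uniformity_bergman = (INF e\<in>{0<..}. principal {(x, y). dist x y < e})"
definition open_bergman :: "bergman set \<Rightarrow> bool" where
  "open_bergman U = (\<forall>x\<in>U. eventually (\<lambda>(x', y). x' = x \<longrightarrow> y \<in> U) uniformity)"
instance
proof
  fix f g h :: bergman and r :: real
  show "dist f g = norm (f - g)" "sgn f = f /\<^sub>R norm f" "norm f = sqrt (inner f f)"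
    by (fact dist_bergman_def sgn_bergman_def norm_bergman_def)+
  show "uniformity = (INF e\<in>{0<..}. principal {(x, y). dist (x::bergman) y < e})"
    by (fact uniformity_bergman_def)
  show "open U = (\<forall>x\<in>U. eventually (\<lambda>(x', y). x' = x \<longrightarrow> y \<in> U) uniformity)"
    for U :: "bergman set"
    by (fact open_bergman_def)
  show "inner f g = inner g f"
    by transfer (simp add: inner_commute)
  show "inner (f + g) h = inner f h + inner g h"
    by transfer (simp add: inner_add_left set_integral_add bergman_functions_inner_integrable
        add_divide_distrib)
  show "inner (r *\<^sub>R f) g = r * inner f g"
    by transfer (simp flip: scaleR_conv_of_real)
  show "0 \<le> inner f f"
    by transfer (auto simp: set_lebesgue_integral_def intro!: integral_nonneg_AE)
  show "inner f f = 0 \<longleftrightarrow> f = 0"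
  proof transfer
    fix f assume f: "f \<in> bergman_functions"
    have int: "integrable lborel (\<lambda>z. indicator (ball 0 1) z *\<^sub>R (f z \<bullet> f z))"
      using bergman_functions_inner_integrable[OF f f] by (simp add: set_integrable_def)
    have cont: "continuous_on (ball 0 1) f"
      using f by (auto simp: bergman_functions_def holomorphic_on_imp_continuous_on)
    have *: "f z = 0" if 0: "(LINT z:ball 0 1|lborel. f z \<bullet> f z) = 0" for z
    proof (rule ccontr)
      assume nz: "f z \<noteq> 0"
      then have z: "z \<in> ball 0 1"
        using f by (auto simp: bergman_functions_def)
      have AE: "AE z in lborel. indicator (ball 0 1) z *\<^sub>R (f z \<bullet> f z) = 0"
        using 0 int
        by (subst (asm) set_lebesgue_integral_def, subst (asm) integral_nonneg_eq_0_iff_AE) auto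
      let ?U = "ball 0 1 \<inter> f -` (- {0})"
      have U: "open ?U"
        using cont by (intro continuous_open_preimage) auto
      have "AE z in lborel. z \<notin> ?U"
        using AE by eventually_elim (auto simp: indicator_def)
      then have "?U \<in> null_sets lborel"
        using U by (subst (asm) AE_iff_null_sets[symmetric]) auto
      then have "negligible ?U"
        by (simp add: negligible_iff_null_sets null_sets_completionI)
      with U have "?U = {}"
        using open_not_negligible by blast
      with nz z show False by auto
    qed
    show "1 / pi * (LINT z:ball 0 1|lborel. f z \<bullet> f z) = 0 \<longleftrightarrow> f = (\<lambda>z. 0)"
    proof (intro iffI)
      assume "1 / pi * (LINT z:ball 0 1|lborel. f z \<bullet> f z) = 0"
      then have "(LINT z:ball 0 1|lborel. f z \<bullet> f z) = 0" by simp
      then show "f = (\<lambda>z. 0)" using * by blast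
    next
      assume "f = (\<lambda>z. 0)"
      then show "1 / pi * (LINT z:ball 0 1|lborel. f z \<bullet> f z) = 0"
        by (simp add: set_lebesgue_integral_def)
    qed
  qed
qed
end

lemma norm_bergman_eq:
  "norm f = sqrt (1 / pi * (LINT z:ball 0 1|lborel. (cmod (Rep_bergman f z))\<^sup>2))"
  unfolding norm_bergman_def by transfer (simp add: power2_norm_eq_inner)

instantiation bergman :: complex_normed_vector
begin
lift_definition scaleC_bergman :: "complex \<Rightarrow> bergman \<Rightarrow> bergman" is "\<lambda>c f z. c * f z"
  by (rule bergman_functions_scale)
instance
proof
  fix a b :: complex and f g :: bergman and r :: real
  show "a *\<^sub>C (f + g) = a *\<^sub>C f + a *\<^sub>C g" "(a + b) *\<^sub>C f = a *\<^sub>C f + b *\<^sub>C f"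
    "a *\<^sub>C b *\<^sub>C f = (a * b) *\<^sub>C f" "of_real r *\<^sub>C f = r *\<^sub>R f"
    by (transfer; simp add: algebra_simps)+
  show "norm (a *\<^sub>C f) = cmod a * norm f"
    unfolding norm_bergman_eq
    by transfer (simp add: norm_mult power_mult_distrib real_sqrt_mult real_sqrt_divide)
qed
end

text \<open>The value is the intended one whenever \<open>f \<circ> \<phi>\<close> is square integrable and holomorphic on
  the disk, which for an automorphism \<open>\<phi>\<close> of the disk holds for every \<open>f\<close> in the space.\<close>

definition composition_operator :: "(complex \<Rightarrow> complex) \<Rightarrow> bergman \<Rightarrow> bergman" where
  "composition_operator \<phi> f =
     Abs_bergman (\<lambda>z. if z \<in> ball 0 1 then Rep_bergman f (\<phi> z) else 0)"

end

theory Submission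
  imports Defs
begin

text \<open>Write \<open>C\<close> for the composition operator of \<open>\<phi>\<close>.

  Every unimodular \<open>\<mu>\<close> is an extended eigenvalue.  If \<open>h\<close> is bounded and holomorphic with
  \<open>h \<circ> \<phi> = \<mu> h\<close>, multiplication \<open>X\<close> by \<open>h\<close> satisfies \<open>C X = \<mu> X C\<close>.  The Cayley transform
  \<open>w = (1 + z) / (1 - z)\<close> turns \<open>\<phi>\<close> into the dilation \<open>w \<mapsto> K w\<close> of the right half-plane with
  \<open>K = (1 + r) / (1 - r)\<close>, so the imaginary power \<open>h = w powr (\<i> \<tau>)\<close> with \<open>\<tau> ln K = Arg \<mu>\<close> will do
  (\<open>ext_eigenvalue_of_unimodular\<close>).

  No other \<open>\<mu>\<close> is possible.  The spectrum of \<open>C\<close> contains an annulus around the unit circle,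
  so it meets the spectrum of \<open>\<mu> C\<close> when \<open>\<bar>\<mu>\<bar>\<close> is near \<open>1\<close> and does not rule out such \<open>\<mu>\<close>; the growth
  of the orbits \<open>C\<^sup>n f\<close> does.  The \<open>n\<close>-th iterate of \<open>\<phi>\<close> is again of the form
  \<open>z \<mapsto> (z + t) / (1 + t z)\<close>, and a change of variables shows that the norm of \<open>C\<^sup>n f\<close> is that of
  \<open>f (1 - t\<^sup>2) / (1 - t z)\<^sup>2\<close>.  It is at least \<open>(1 - t\<^sup>2) / 4\<close> times the norm of \<open>f\<close>, and for
  \<open>f = (1 - z)\<^sup>2 g\<close> it is at most \<open>4 (1 - t\<^sup>2)\<close> times the norm of \<open>g\<close>.  If \<open>C X = \<mu> X C\<close> with
  \<open>\<bar>\<mu>\<bar> < 1\<close>, comparing both sides of \<open>C\<^sup>n X f = \<mu>\<^sup>n X C\<^sup>n f\<close> for such \<open>f\<close> forces \<open>X f = 0\<close>, and these \<open>f\<close>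
  are dense (\<open>contracting_intertwiner_zero\<close>).  For \<open>\<bar>\<mu>\<bar> > 1\<close> the same argument applies to the inverse
  of \<open>C\<close>, with the repelling fixed point \<open>- 1\<close> in the place of \<open>1\<close>.\<close>

section \<open>Area integrals and holomorphic changes of variables\<close>

definition plane_to_complex :: "real^2 \<Rightarrow> complex" where
  "plane_to_complex x = Complex (x $ 1) (x $ 2)"

definition complex_to_plane :: "complex \<Rightarrow> real^2" where
  "complex_to_plane z = vector [Re z, Im z]"

lemma plane_complex_inverse [simp]:
  "plane_to_complex (complex_to_plane z) = z"
  "complex_to_plane (plane_to_complex x) = x"
  by (simp_all add: plane_to_complex_def complex_to_plane_def vector_2 vec_eq_iff forall_2)

lemma bounded_linear_plane_to_complex: "bounded_linear plane_to_complex"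
  unfolding linear_conv_bounded_linear[symmetric]
  by (rule linearI) (auto simp: plane_to_complex_def complex_eq_iff)

lemma bounded_linear_complex_to_plane: "bounded_linear complex_to_plane"
  unfolding linear_conv_bounded_linear[symmetric]
  by (rule linearI) (auto simp: complex_to_plane_def vec_eq_iff forall_2 vector_2)

lemma plane_to_complex_measurable [measurable]: "plane_to_complex \<in> borel_measurable borel"
  by (intro borel_measurable_continuous_onI
      linear_continuous_on[OF bounded_linear_plane_to_complex])

text \<open>The standard identification of the real plane with \<open>\<complex>\<close> maps boxes to boxes of the same side
  lengths, hence preserves area.\<close>

lemma lborel_complex_eq_distr_plane: "lborel = distr lborel borel plane_to_complex"
proof (rule lborel_eqI)
  fix l u :: complex
  assume le: "\<And>b. b \<in> Basis \<Longrightarrow> l \<bullet> b \<le> u \<bullet> b"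
  have vim: "plane_to_complex -` box l u = box (complex_to_plane l) (complex_to_plane u)"
    by (auto simp: plane_to_complex_def complex_to_plane_def in_box_complex_iff mem_box_cart
        forall_2 vector_2)
  have B: "(Basis :: (real^2) set) = {axis 1 1, axis 2 1}"
    by (auto simp: Basis_vec_def UNIV_2)
  have ne: "axis (1::2) (1::real) \<noteq> axis 2 1"
    by (simp add: axis_eq_axis)
  have "emeasure (distr lborel borel plane_to_complex) (box l u)
      = emeasure lborel (box (complex_to_plane l) (complex_to_plane u))"
    by (subst emeasure_distr) (auto simp: vim)
  also have "\<dots> = (\<Prod>b\<in>Basis. (u - l) \<bullet> b)"
    using le[of 1] le[of \<i>] ne
    by (subst emeasure_lborel_box)
       (auto simp: B Basis_complex_def complex_to_plane_def vector_2 inner_axis ennreal_mult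
         inner_diff_left)
  finally show "emeasure (distr lborel borel plane_to_complex) (box l u)
      = (\<Prod>b\<in>Basis. (u - l) \<bullet> b)" .
qed auto

text \<open>The change of variables theorem for vectors of reals speaks of absolute Lebesgue integrals of
  vector-valued functions, the Bergman space of Borel integrals over the complex plane.  This is
  the dictionary between the two; the trivial \<open>vec\<close> makes a real function vector-valued.\<close>

lemma area_integral_plane:
  fixes F :: "complex \<Rightarrow> real"
  assumes S: "open S" and F: "continuous_on S F"
  shows "set_integrable lborel S F \<longleftrightarrow>
      (\<lambda>x. vec (F (plane_to_complex x)) :: real^1) absolutely_integrable_on plane_to_complex -` S"
    and "(\<lambda>x. vec (F (plane_to_complex x)) :: real^1) absolutely_integrable_on plane_to_complex -` S
     \<Longrightarrow> integral (plane_to_complex -` S) (\<lambda>x. vec (F (plane_to_complex x)) :: real^1)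
      = vec (LINT z:S|lborel. F z)"
proof -
  let ?T = "plane_to_complex -` S"
  have m [measurable]: "(\<lambda>z. indicator S z *\<^sub>R F z) \<in> borel_measurable borel"
    using S F by (intro borel_measurable_continuous_on_indicator) auto
  have m2: "(\<lambda>x. indicator ?T x *\<^sub>R F (plane_to_complex x)) \<in> borel_measurable lborel"
    using measurable_compose[OF plane_to_complex_measurable m] by (simp add: indicator_def)
  have ind: "(\<lambda>x. indicator S (plane_to_complex x) *\<^sub>R F (plane_to_complex x))
     = (\<lambda>x. indicator ?T x *\<^sub>R F (plane_to_complex x))"
    by (auto simp: indicator_def)
  have a: "set_integrable lborel S F \<longleftrightarrow> (\<lambda>x. F (plane_to_complex x)) absolutely_integrable_on ?T"
    unfolding set_integrable_def unfolding integrable_completion[OF m2] unfolding ind[symmetric]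
    by (subst lborel_complex_eq_distr_plane, rule integrable_distr_eq[OF _ m]) simp
  have b: "(\<lambda>x. vec (f x) :: real^1) absolutely_integrable_on T
      \<longleftrightarrow> f absolutely_integrable_on T" for f :: "real^2 \<Rightarrow> real" and T
    by (subst absolutely_integrable_componentwise_iff)
       (simp add: Basis_vec_def inner_axis)
  show "set_integrable lborel S F \<longleftrightarrow>
      (\<lambda>x. vec (F (plane_to_complex x)) :: real^1) absolutely_integrable_on ?T"
    by (simp add: a b)
  assume "(\<lambda>x. vec (F (plane_to_complex x)) :: real^1) absolutely_integrable_on ?T"
  then have abs: "(\<lambda>x. F (plane_to_complex x)) absolutely_integrable_on ?T" by (simp add: b)
  have "(LINT z:S|lborel. F z) = (LINT x:?T|lebesgue. F (plane_to_complex x))"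
    unfolding set_lebesgue_integral_def unfolding integral_completion[OF m2] unfolding ind[symmetric]
    by (subst lborel_complex_eq_distr_plane, rule integral_distr[OF _ m]) simp
  also have "\<dots> = integral ?T (\<lambda>x. F (plane_to_complex x))"
    using abs by (rule set_lebesgue_integral_eq_integral)
  finally have "((\<lambda>x. F (plane_to_complex x)) has_integral (LINT z:S|lborel. F z)) ?T"
    using set_lebesgue_integral_eq_integral(1)[OF abs] by (simp add: has_integral_integral)
  then have "((\<lambda>x. vec (F (plane_to_complex x)) :: real^1) has_integral vec (LINT z:S|lborel. F z)) ?T"
    by (subst has_integral_componentwise_iff) (simp add: Basis_vec_def inner_axis)
  then show "integral ?T (\<lambda>x. vec (F (plane_to_complex x)) :: real^1) = vec (LINT z:S|lborel. F z)"
    by (rule integral_unique)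
qed

text \<open>Multiplication by \<open>g' z\<close> is a rotation combined with a scaling by \<open>\<bar>g' z\<bar>\<close>, so the Jacobian
  determinant of a holomorphic map is \<open>\<bar>g' z\<bar>\<^sup>2\<close>.\<close>

lemma area_change_of_variables:
  fixes g :: "complex \<Rightarrow> complex" and F :: "complex \<Rightarrow> real"
  assumes S: "open S" and g: "g holomorphic_on S" and inj: "inj_on g S"
    and F: "continuous_on (g ` S) F"
  shows "set_integrable lborel (g ` S) F
      \<longleftrightarrow> set_integrable lborel S (\<lambda>z. (cmod (deriv g z))\<^sup>2 * F (g z))"
    and "set_integrable lborel (g ` S) F
      \<Longrightarrow> (LINT z:S|lborel. (cmod (deriv g z))\<^sup>2 * F (g z)) = (LINT w:g ` S|lborel. F w)"
proof -
  let ?T = "plane_to_complex -` S"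
  define G where "G = complex_to_plane \<circ> g \<circ> plane_to_complex"
  define G' where "G' x h = complex_to_plane (deriv g (plane_to_complex x) * plane_to_complex h)" for x h
  have img: "G ` ?T = plane_to_complex -` (g ` S)"
    unfolding G_def set_eq_iff image_iff vimage_eq Bex_def o_def
    by (metis plane_complex_inverse)
  have openT: "open ?T"
    using S by (intro open_vimage linear_continuous_on bounded_linear_plane_to_complex)
  have der: "(G has_derivative G' x) (at x within ?T)" if "x \<in> ?T" for x
  proof -
    have "(g has_field_derivative deriv g (plane_to_complex x)) (at (plane_to_complex x))"
      using that S g by (auto intro: holomorphic_derivI)
    then have "(g has_derivative (*) (deriv g (plane_to_complex x))) (at (plane_to_complex x))"
      by (simp add: has_field_derivative_def)
    then have "((\<lambda>x. g (plane_to_complex x)) has_derivative (\<lambda>h. deriv g (plane_to_complex x) * plane_to_complex h))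
       (at x within ?T)"
      by (rule has_derivative_compose[rotated])
         (rule bounded_linear_imp_has_derivative[OF bounded_linear_plane_to_complex])
    then show ?thesis
      unfolding G_def G'_def o_def
      by (rule bounded_linear.has_derivative[OF bounded_linear_complex_to_plane])
  qed
  have det: "\<bar>det (matrix (G' x))\<bar> = (cmod (deriv g (plane_to_complex x)))\<^sup>2" for x
    unfolding cmod_power2
    by (simp add: det_2 matrix_def G'_def complex_to_plane_def plane_to_complex_def vector_2
        axis_def power2_eq_square)
  have injG: "inj_on G ?T"
    using inj unfolding G_def inj_on_def o_def by (metis plane_complex_inverse vimageE)
  have Sl: "?T \<in> sets lebesgue" using openT by (simp add: borel_open)
  have GS: "open (g ` S)"
    using open_mapping_thm3[OF g S inj] .
  have dg: "continuous_on S (deriv g)"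
    using g S by (intro holomorphic_on_imp_continuous_on holomorphic_deriv)
  have cont: "continuous_on S (\<lambda>z. (cmod (deriv g z))\<^sup>2 * F (g z))"
    using F g by (intro continuous_intros dg continuous_on_compose2[OF F]
        holomorphic_on_imp_continuous_on) auto
  note cov = has_absolute_integral_change_of_variables[OF Sl der injG,
      of "\<lambda>x. vec (F (plane_to_complex x)) :: real^1", unfolded img det]
  have eq: "(cmod (deriv g (plane_to_complex x)))\<^sup>2 *\<^sub>R vec (F (plane_to_complex (G x)))
     = (vec ((cmod (deriv g (plane_to_complex x)))\<^sup>2 * F (g (plane_to_complex x))) :: real^1)" for x
    by (simp add: G_def vec_eq_iff)
  note cov' = cov[unfolded eq]
  show iff: "set_integrable lborel (g ` S) F
      \<longleftrightarrow> set_integrable lborel S (\<lambda>z. (cmod (deriv g z))\<^sup>2 * F (g z))"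
    unfolding area_integral_plane(1)[OF GS F] area_integral_plane(1)[OF S cont]
    using cov' by blast
  assume i: "set_integrable lborel (g ` S) F"
  note j = i[unfolded area_integral_plane(1)[OF GS F]]
    and k = i[unfolded iff area_integral_plane(1)[OF S cont]]
  have "(vec (LINT z:S|lborel. (cmod (deriv g z))\<^sup>2 * F (g z)) :: real^1) = vec (LINT w:g ` S|lborel. F w)"
    using cov' j k area_integral_plane(2)[OF GS F j] area_integral_plane(2)[OF S cont k] by metis
  then show "(LINT z:S|lborel. (cmod (deriv g z))\<^sup>2 * F (g z)) = (LINT w:g ` S|lborel. F w)"
    by (simp add: vec_eq_iff)
qed

section \<open>Multiplication operators on the Bergman space\<close>

lemma Rep_bergman_properties:
  shows Rep_bergman_holomorphic: "Rep_bergman f holomorphic_on ball 0 1"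
    and Rep_bergman_square_integrable:
      "set_integrable lborel (ball 0 1) (\<lambda>z. (cmod (Rep_bergman f z))\<^sup>2)"
    and Rep_bergman_outside: "z \<notin> ball 0 1 \<Longrightarrow> Rep_bergman f z = 0"
  using Rep_bergman[of f] by (auto simp: bergman_functions_def)

lemma bergman_eqI:
  assumes "\<And>z. z \<in> ball 0 1 \<Longrightarrow> Rep_bergman f z = Rep_bergman g z"
  shows "f = g"
  using assms Rep_bergman_outside by (intro Rep_bergman_inject[THEN iffD1] ext) metis

lemma bergman_functionsI:
  assumes hol: "f holomorphic_on ball 0 1"
    and int: "set_integrable lborel (ball 0 1) (\<lambda>z. (cmod (f z))\<^sup>2)"
  shows "(\<lambda>z. if z \<in> ball 0 1 then f z else 0) \<in> bergman_functions"
proof -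
  have "(\<lambda>z. if z \<in> ball 0 1 then f z else 0) holomorphic_on ball 0 1"
    using hol by (rule holomorphic_transform) auto
  moreover have "set_integrable lborel (ball 0 1)
      (\<lambda>z. (cmod (if z \<in> ball 0 1 then f z else 0))\<^sup>2)"
    using int by (subst set_integrable_cong[OF refl refl]) auto
  ultimately show ?thesis by (simp add: bergman_functions_def)
qed

lemma norm_bergman_mono:
  assumes "0 \<le> c"
    and le: "\<And>z. z \<in> ball 0 1 \<Longrightarrow> cmod (Rep_bergman f z) \<le> c * cmod (Rep_bergman g z)"
  shows "norm f \<le> c * norm g"
proof -
  have "(LINT z:ball 0 1|lborel. (cmod (Rep_bergman f z))\<^sup>2)
      \<le> (LINT z:ball 0 1|lborel. c\<^sup>2 * (cmod (Rep_bergman g z))\<^sup>2)"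
    using power_mono[OF le, of _ 2]
    by (intro set_integral_mono Rep_bergman_square_integrable set_integrable_mult_right)
       (auto simp: power_mult_distrib)
  also have "\<dots> = c\<^sup>2 * (LINT z:ball 0 1|lborel. (cmod (Rep_bergman g z))\<^sup>2)"
    by simp
  finally have "(norm f)\<^sup>2 \<le> (c * norm g)\<^sup>2"
    unfolding norm_bergman_eq power_mult_distrib
    by (auto simp: divide_right_mono set_lebesgue_integral_def field_simps
          intro!: integral_nonneg_AE)
  then show ?thesis
    using \<open>0 \<le> c\<close> by (auto intro: power2_le_imp_le)
qed

definition multiplication_operator :: "(complex \<Rightarrow> complex) \<Rightarrow> bergman \<Rightarrow> bergman" where
  "multiplication_operator h f =
     Abs_bergman (\<lambda>z. if z \<in> ball 0 1 then h z * Rep_bergman f z else 0)"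

lemma Rep_multiplication_operator:
  assumes h: "h holomorphic_on ball 0 1" and bd: "\<And>z. z \<in> ball 0 1 \<Longrightarrow> cmod (h z) \<le> B"
    and z: "z \<in> ball 0 1"
  shows "Rep_bergman (multiplication_operator h f) z = h z * Rep_bergman f z"
proof -
  let ?f = "Rep_bergman f"
  have hf: "(\<lambda>z. h z * ?f z) holomorphic_on ball 0 1"
    by (intro holomorphic_intros h Rep_bergman_holomorphic)
  have "set_integrable lborel (ball 0 1) (\<lambda>z. B\<^sup>2 * (cmod (?f z))\<^sup>2)"
    by (intro set_integrable_mult_right Rep_bergman_square_integrable)
  then have "set_integrable lborel (ball 0 1) (\<lambda>z. (cmod (h z * ?f z))\<^sup>2)"
    unfolding set_integrable_def
  proof (rule Bochner_Integration.integrable_bound)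
    have "continuous_on (ball 0 1) (\<lambda>z. (cmod (h z * ?f z))\<^sup>2)"
      by (intro continuous_intros holomorphic_on_imp_continuous_on h Rep_bergman_holomorphic)
    then show "(\<lambda>z. indicator (ball 0 1) z *\<^sub>R (cmod (h z * ?f z))\<^sup>2) \<in> borel_measurable lborel"
      unfolding measurable_lborel2
      by (intro borel_measurable_continuous_on_indicator borel_open open_ball)
    have "(cmod (h z))\<^sup>2 * (cmod (?f z))\<^sup>2 \<le> B\<^sup>2 * (cmod (?f z))\<^sup>2" if "z \<in> ball 0 1" for z
      using bd[OF that] by (intro mult_right_mono power_mono) auto
    then show "AE z in lborel. norm (indicator (ball 0 1) z *\<^sub>R (cmod (h z * ?f z))\<^sup>2)
        \<le> norm (indicator (ball 0 1) z *\<^sub>R (B\<^sup>2 * (cmod (?f z))\<^sup>2))"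
      by (intro AE_I2) (auto simp: indicator_def norm_mult power_mult_distrib)
  qed
  then have "(\<lambda>z. if z \<in> ball 0 1 then h z * ?f z else 0) \<in> bergman_functions"
    using bergman_functionsI[OF hf] by simp
  then show ?thesis
    using z by (simp add: multiplication_operator_def Abs_bergman_inverse)
qed

lemma bounded_clinear_multiplication_operator:
  assumes h: "h holomorphic_on ball 0 1" and bd: "\<And>z. z \<in> ball 0 1 \<Longrightarrow> cmod (h z) \<le> B"
  shows "bounded_clinear (multiplication_operator h)"
proof -
  note rep = Rep_multiplication_operator[OF h bd]
  have "0 \<le> B" using bd[of 0] norm_ge_zero[of "h 0"] by (simp del: norm_ge_zero)
  have "bounded_linear (multiplication_operator h)"
  proof (rule bounded_linear_intro[where K = B])
    fix f g :: bergman and c :: real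
    show "multiplication_operator h (f + g) = multiplication_operator h f + multiplication_operator h g"
      by (rule bergman_eqI) (simp add: rep plus_bergman.rep_eq distrib_left del: mem_ball mem_ball_0)
    show "multiplication_operator h (c *\<^sub>R f) = c *\<^sub>R multiplication_operator h f"
      by (rule bergman_eqI) (simp add: rep scaleR_bergman.rep_eq del: mem_ball mem_ball_0)
    have "norm (multiplication_operator h f) \<le> B * norm f"
      using \<open>0 \<le> B\<close> by (rule norm_bergman_mono) (simp add: rep norm_mult bd mult_right_mono del: mem_ball mem_ball_0)
    then show "norm (multiplication_operator h f) \<le> norm f * B" by (simp add: mult.commute)
  qed
  moreover have "multiplication_operator h (c *\<^sub>C f) = c *\<^sub>C multiplication_operator h f" for c f
    by (rule bergman_eqI) (simp add: rep scaleC_bergman.rep_eq del: mem_ball mem_ball_0)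
  ultimately show ?thesis by (simp add: bounded_clinear_def)
qed

section \<open>Hyperbolic translations of the disk\<close>

text \<open>For \<open>\<bar>s\<bar> < 1\<close> these are the hyperbolic automorphisms of the disk with fixed points \<open>1\<close> and \<open>- 1\<close>
  (and the identity).  They form a one-parameter group: \<open>s\<close> adds like a velocity in special
  relativity.\<close>

definition disk_translation :: "real \<Rightarrow> complex \<Rightarrow> complex" where
  "disk_translation s z = (z + of_real s) / (1 + of_real s * z)"

lemma disk_translation_denominator:
  assumes "\<bar>s\<bar> < 1" "z \<in> ball 0 1"
  shows "1 - \<bar>s\<bar> \<le> cmod (1 + of_real s * z)" and "1 + of_real s * z \<noteq> 0"
proof -
  have "cmod (of_real s * z) \<le> \<bar>s\<bar>"
    using assms by (simp add: norm_mult mult_left_le)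
  then show "1 - \<bar>s\<bar> \<le> cmod (1 + of_real s * z)"
    using norm_diff_ineq[of 1 "of_real s * z"] by simp
  then show "1 + of_real s * z \<noteq> 0" using assms by auto
qed

lemma disk_translation_Moebius: "disk_translation s = Moebius_function 0 (of_real (- s))"
  by (simp add: fun_eq_iff disk_translation_def Moebius_function_simple)

lemma disk_translation_in_ball:
  "\<bar>s\<bar> < 1 \<Longrightarrow> z \<in> ball 0 1 \<Longrightarrow> disk_translation s z \<in> ball 0 1"
  by (simp add: disk_translation_Moebius Moebius_function_norm_lt_1)

lemma disk_translation_holomorphic:
  "\<bar>s\<bar> < 1 \<Longrightarrow> disk_translation s holomorphic_on ball 0 1"
  by (simp add: disk_translation_Moebius Moebius_function_holomorphic)

lemma disk_translation_inverse:
  "\<bar>s\<bar> < 1 \<Longrightarrow> z \<in> ball 0 1 \<Longrightarrow> disk_translation s (disk_translation (- s) z) = z"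
  unfolding disk_translation_Moebius by (intro Moebius_function_compose) auto

lemma disk_translation_image:
  assumes "\<bar>s\<bar> < 1" shows "disk_translation s ` ball 0 1 = ball 0 1"
proof (rule subset_antisym)
  show "disk_translation s ` ball 0 1 \<subseteq> ball 0 1"
    using disk_translation_in_ball[OF assms] by blast
  show "ball 0 1 \<subseteq> disk_translation s ` ball 0 1"
    using disk_translation_inverse[OF assms] disk_translation_in_ball[of "- s"] assms
    by (metis abs_minus_cancel image_eqI subsetI)
qed

lemma inj_on_disk_translation:
  assumes "\<bar>s\<bar> < 1" shows "inj_on (disk_translation s) (ball 0 1)"
  using disk_translation_inverse[of "- s"] assms by (intro inj_on_inverseI[where g = "disk_translation (- s)"]) auto

lemma deriv_disk_translation:
  assumes s: "\<bar>s\<bar> < 1" and z: "z \<in> ball 0 1"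
  shows "deriv (disk_translation (- s)) z = (1 - (of_real s)\<^sup>2) / (1 - of_real s * z)\<^sup>2"
proof (rule DERIV_imp_deriv)
  have ne: "1 - of_real s * z \<noteq> 0"
    using disk_translation_denominator(2)[of "- s" z] s z by simp
  have "((\<lambda>z. (z - of_real s) / (1 - of_real s * z)) has_field_derivative
      (1 - (of_real s)\<^sup>2) / (1 - of_real s * z)\<^sup>2) (at z)"
    using ne by (auto intro!: derivative_eq_intros simp: field_simps power2_eq_square)
  then show "(disk_translation (- s) has_field_derivative
      (1 - (of_real s)\<^sup>2) / (1 - of_real s * z)\<^sup>2) (at z)"
    by (simp add: disk_translation_def[abs_def])
qed

lemma velocity_addition_bound:
  fixes s t :: real
  assumes s: "\<bar>s\<bar> < 1" and t: "\<bar>t\<bar> < 1"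
  shows "\<bar>(s + t) / (1 + s * t)\<bar> < 1" and "0 < 1 + s * t"
proof -
  have "\<bar>s * t\<bar> < 1"
    using s t mult_strict_mono'[of "\<bar>s\<bar>" 1 "\<bar>t\<bar>" 1] by (simp add: abs_mult)
  then show pos: "0 < 1 + s * t" by linarith
  have "0 < (1 - s) * (1 - t)" "0 < (1 + s) * (1 + t)" using s t by auto
  then have "\<bar>s + t\<bar> < 1 + s * t" by (simp add: algebra_simps abs_less_iff)
  then show "\<bar>(s + t) / (1 + s * t)\<bar> < 1" using pos by simp
qed

lemma disk_translation_compose:
  assumes s: "\<bar>s\<bar> < 1" and t: "\<bar>t\<bar> < 1" and z: "z \<in> ball 0 1"
  shows "disk_translation t (disk_translation s z) = disk_translation ((s + t) / (1 + s * t)) z"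
proof -
  let ?S = "complex_of_real s" and ?T = "complex_of_real t"
  have a: "1 + ?S * z \<noteq> 0" using disk_translation_denominator s z by blast
  have b: "1 + ?S * ?T \<noteq> 0"
    using velocity_addition_bound(2)[OF s t]
    by (metis of_real_1 of_real_add of_real_eq_0_iff of_real_mult less_irrefl)
  have "1 + ?T * ((z + ?S) / (1 + ?S * z)) \<noteq> 0"
    using disk_translation_denominator(2)[OF t disk_translation_in_ball[OF s z]]
    by (simp add: disk_translation_def)
  moreover have "1 + (?S + ?T) / (1 + ?S * ?T) * z \<noteq> 0"
    using disk_translation_denominator(2)[OF velocity_addition_bound(1)[OF s t] z] by simp
  ultimately show ?thesis
    using a b unfolding disk_translation_def by (simp add: divide_simps) (simp add: algebra_simps)
qed

section \<open>Norm estimates for composition with translations\<close>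

definition translation_operator :: "real \<Rightarrow> bergman \<Rightarrow> bergman" where
  "translation_operator s = composition_operator (disk_translation s)"

text \<open>The derivative of the inverse translation, that is, of \<open>disk_translation (- s)\<close>.\<close>

definition translation_weight :: "real \<Rightarrow> complex \<Rightarrow> complex" where
  "translation_weight s z = (1 - (of_real s)\<^sup>2) / (1 - of_real s * z)\<^sup>2"

lemma norm_translation_weight:
  assumes "\<bar>s\<bar> < 1"
  shows "cmod (translation_weight s z) = (1 - s\<^sup>2) / (cmod (1 - of_real s * z))\<^sup>2"
proof -
  have "s\<^sup>2 < 1" using assms by (simp add: abs_square_less_1)
  then have "cmod (1 - (of_real s)\<^sup>2) = 1 - s\<^sup>2"
    by (metis abs_of_pos diff_gt_0_iff_gt norm_of_real of_real_1 of_real_diff of_real_power)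
  then show ?thesis by (simp add: translation_weight_def norm_divide norm_power)
qed

lemma translation_weight_holomorphic:
  assumes "\<bar>s\<bar> < 1" shows "translation_weight s holomorphic_on ball 0 1"
  unfolding translation_weight_def[abs_def]
  using disk_translation_denominator(2)[of "- s"] assms by (intro holomorphic_intros) auto

lemma translation_weight_bounded:
  assumes s: "\<bar>s\<bar> < 1" and z: "z \<in> ball 0 1"
  shows "cmod (translation_weight s z) \<le> (1 - s\<^sup>2) / (1 - \<bar>s\<bar>)\<^sup>2"
  unfolding norm_translation_weight[OF s]
  using disk_translation_denominator(1)[of "- s" z] s z
  by (intro divide_left_mono power_mono mult_pos_pos) (auto simp: abs_square_le_1)

lemma Rep_translation_weight:
  assumes s: "\<bar>s\<bar> < 1" and z: "z \<in> ball 0 1"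
  shows "Rep_bergman (multiplication_operator (translation_weight s) f) z
    = translation_weight s z * Rep_bergman f z"
  using translation_weight_holomorphic[OF s] translation_weight_bounded[OF s] z
  by (rule Rep_multiplication_operator)

text \<open>Substituting the inverse translation turns \<open>\<bar>f \<circ> \<phi>\<bar>\<^sup>2\<close> into \<open>\<bar>f\<bar>\<^sup>2\<close> times the squared modulus of the
  derivative.  Expressing the result as a multiplication operator reduces norm estimates for
  translations to pointwise estimates of the weight.\<close>

lemma translation_operator_change_of_variables:
  assumes s: "\<bar>s\<bar> < 1"
  shows "set_integrable lborel (ball 0 1) (\<lambda>z. (cmod (Rep_bergman f (disk_translation s z)))\<^sup>2)"
    and "(LINT z:ball 0 1|lborel. (cmod (Rep_bergman f (disk_translation s z)))\<^sup>2) =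
      (LINT z:ball 0 1|lborel.
        (cmod (Rep_bergman (multiplication_operator (translation_weight s) f) z))\<^sup>2)"
proof -
  let ?D = "ball 0 1 :: complex set" and ?g = "disk_translation (- s)"
  let ?F = "\<lambda>z. (cmod (Rep_bergman f (disk_translation s z)))\<^sup>2"
  let ?M = "multiplication_operator (translation_weight s) f"
  have s': "\<bar>- s\<bar> < 1" using s by simp
  have cont: "continuous_on (?g ` ?D) ?F"
    unfolding disk_translation_image[OF s']
    using disk_translation_in_ball[OF s]
    by (intro continuous_intros continuous_on_compose2[OF holomorphic_on_imp_continuous_on[OF Rep_bergman_holomorphic]]
        holomorphic_on_imp_continuous_on disk_translation_holomorphic s) auto
  have eq: "(cmod (deriv ?g z))\<^sup>2 * ?F (?g z) = (cmod (Rep_bergman ?M z))\<^sup>2" if z: "z \<in> ?D" for z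
    by (simp only: Rep_translation_weight[OF s z] deriv_disk_translation[OF s z]
        disk_translation_inverse[OF s z] translation_weight_def norm_mult power_mult_distrib)
  note cov = area_change_of_variables[OF open_ball disk_translation_holomorphic[OF s'] inj_on_disk_translation[OF s'] cont,
      unfolded disk_translation_image[OF s']]
  have "set_integrable lborel ?D (\<lambda>z. (cmod (deriv ?g z))\<^sup>2 * ?F (?g z))"
    using Rep_bergman_square_integrable[of ?M] by (subst set_integrable_cong[OF refl refl eq])
  then show int: "set_integrable lborel ?D ?F" using cov(1) by simp
  have "(LINT z:?D|lborel. ?F z) = (LINT z:?D|lborel. (cmod (deriv ?g z))\<^sup>2 * ?F (?g z))"
    using cov(2)[OF int] by simp
  also have "\<dots> = (LINT z:?D|lborel. (cmod (Rep_bergman ?M z))\<^sup>2)"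
    by (rule set_lebesgue_integral_cong) (auto simp: eq simp del: mem_ball mem_ball_0)
  finally show "(LINT z:?D|lborel. ?F z) = (LINT z:?D|lborel. (cmod (Rep_bergman ?M z))\<^sup>2)" .
qed

lemma Rep_translation_operator:
  assumes s: "\<bar>s\<bar> < 1" and z: "z \<in> ball 0 1"
  shows "Rep_bergman (translation_operator s f) z = Rep_bergman f (disk_translation s z)"
proof -
  have "(\<lambda>z. Rep_bergman f (disk_translation s z)) holomorphic_on ball 0 1"
    using holomorphic_on_compose_gen[OF disk_translation_holomorphic[OF s] Rep_bergman_holomorphic]
      disk_translation_image[OF s] by (simp add: o_def)
  from bergman_functionsI[OF this translation_operator_change_of_variables(1)[OF s]] z
  show ?thesis
    by (simp add: translation_operator_def composition_operator_def Abs_bergman_inverse)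
qed

lemma norm_translation_operator:
  assumes s: "\<bar>s\<bar> < 1"
  shows "norm (translation_operator s f) = norm (multiplication_operator (translation_weight s) f)"
proof -
  have "(LINT z:ball 0 1|lborel. (cmod (Rep_bergman (translation_operator s f) z))\<^sup>2)
      = (LINT z:ball 0 1|lborel. (cmod (Rep_bergman f (disk_translation s z)))\<^sup>2)"
    by (rule set_lebesgue_integral_cong) (auto simp: Rep_translation_operator[OF s] simp del: mem_ball mem_ball_0)
  then show ?thesis
    by (simp add: norm_bergman_eq translation_operator_change_of_variables(2)[OF s])
qed

text \<open>The weight is at least \<open>(1 - s\<^sup>2) / 4\<close> on the disk, because \<open>\<bar>1 - s z\<bar> \<le> 2\<close> there.\<close>

lemma norm_translation_operator_lower:
  assumes s: "\<bar>s\<bar> < 1"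
  shows "(1 - s\<^sup>2) / 4 * norm f \<le> norm (translation_operator s f)"
proof -
  have s2: "0 < 1 - s\<^sup>2" using s by (simp add: abs_square_less_1)
  have "norm f \<le> 4 / (1 - s\<^sup>2) * norm (multiplication_operator (translation_weight s) f)"
  proof (rule norm_bergman_mono)
    fix z :: complex assume z: "z \<in> ball 0 1"
    have "0 < cmod (1 - of_real s * z)" 
      using disk_translation_denominator(2)[of "- s" z] s z by simp
    moreover have "cmod (1 - of_real s * z) \<le> 1 + cmod (of_real s * z)"
      using norm_triangle_ineq4[of 1 "of_real s * z"] by simp
    then have "cmod (1 - of_real s * z) \<le> 2"
      using s z mult_mono[of "\<bar>s\<bar>" 1 "cmod z" 1] by (simp add: norm_mult)
    then have "(cmod (1 - of_real s * z))\<^sup>2 \<le> 2\<^sup>2" by (intro power_mono) auto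
    ultimately have "1 \<le> 4 / (1 - s\<^sup>2) * cmod (translation_weight s z)"
      using s2 mult_left_mono[of "(cmod (1 - of_real s * z))\<^sup>2" 4 "1 - s\<^sup>2"]
      by (simp add: norm_translation_weight[OF s] le_divide_eq)
    from mult_right_mono[OF this norm_ge_zero]
    show "cmod (Rep_bergman f z)
        \<le> 4 / (1 - s\<^sup>2) * cmod (Rep_bergman (multiplication_operator (translation_weight s) f) z)"
      by (simp only: Rep_translation_weight[OF s z] norm_mult mult_1_left mult.assoc)
  qed (use s2 in simp)
  then show ?thesis using s2 by (simp add: norm_translation_operator[OF s] field_simps)
qed

text \<open>The weight is large only near the boundary point \<open>\<sigma>\<close> towards which the translation moves.  A
  double zero there compensates for this uniformly in \<open>s\<close>, since \<open>\<bar>1 - \<sigma> z\<bar> \<le> 2 \<bar>1 - s z\<bar>\<close>.  The bound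
  therefore has the same order \<open>1 - s\<^sup>2\<close> as the lower bound that holds for every function.\<close>

lemma norm_translation_operator_upper:
  assumes s: "\<bar>s\<bar> < 1" and \<sigma>: "\<sigma> = 1 \<or> \<sigma> = - 1" and sign: "0 \<le> \<sigma> * s"
    and f: "\<And>z. z \<in> ball 0 1 \<Longrightarrow> Rep_bergman f z = (1 - of_real \<sigma> * z)\<^sup>2 * Rep_bergman g z"
  shows "norm (translation_operator s f) \<le> 4 * (1 - s\<^sup>2) * norm g"
  unfolding norm_translation_operator[OF s]
proof (rule norm_bergman_mono)
  have s2: "0 < 1 - s\<^sup>2" using s by (simp add: abs_square_less_1)
  then show "0 \<le> 4 * (1 - s\<^sup>2)" by simp
  fix z :: complex assume z: "z \<in> ball 0 1"
  have pos: "0 < cmod (1 - of_real s * z)" 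
    using disk_translation_denominator(2)[of "- s" z] s z by simp
  have \<sigma>s: "\<bar>\<sigma> - s\<bar> = 1 - \<bar>s\<bar>" using s \<sigma> sign by auto
  have "1 - of_real \<sigma> * z = (1 - of_real s * z) - of_real (\<sigma> - s) * z"
    by (simp add: algebra_simps)
  then have "cmod (1 - of_real \<sigma> * z) \<le> cmod (1 - of_real s * z) + cmod (of_real (\<sigma> - s) * z)"
    by (metis norm_triangle_ineq4)
  also have "cmod (of_real (\<sigma> - s) * z) = (1 - \<bar>s\<bar>) * cmod z"
    by (simp only: norm_mult norm_of_real \<sigma>s)
  also have "\<dots> \<le> 1 - \<bar>s\<bar>" using z s by (intro mult_left_le) auto
  also have "\<dots> \<le> cmod (1 - of_real s * z)"
    using disk_translation_denominator(1)[of "- s" z] s z by simp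
  finally have "(cmod (1 - of_real \<sigma> * z))\<^sup>2 \<le> (2 * cmod (1 - of_real s * z))\<^sup>2"
    by (intro power_mono) auto
  from mult_left_mono[OF this less_imp_le[OF s2]]
  have "(1 - s\<^sup>2) * (cmod (1 - of_real \<sigma> * z))\<^sup>2 \<le> 4 * (1 - s\<^sup>2) * (cmod (1 - of_real s * z))\<^sup>2"
    by (simp only: power_mult_distrib mult_ac) simp
  then have "cmod (translation_weight s z) * (cmod (1 - of_real \<sigma> * z))\<^sup>2 \<le> 4 * (1 - s\<^sup>2)"
    using pos unfolding norm_translation_weight[OF s] times_divide_eq_left
    by (simp only: pos_divide_le_eq zero_less_power)
  from mult_right_mono[OF this, of "cmod (Rep_bergman g z)"]
  show "cmod (Rep_bergman (multiplication_operator (translation_weight s) f) z)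
      \<le> 4 * (1 - s\<^sup>2) * cmod (Rep_bergman g z)"
    unfolding Rep_translation_weight[OF s z]
        f[OF z] norm_mult norm_power by (simp add: mult.assoc)
qed

section \<open>Intertwining operators with factor inside the unit disk\<close>

text \<open>The sign condition says that the translation is the identity or moves points towards \<open>\<sigma>\<close>.  It
  survives iteration, so that the norm estimates apply to all powers with the same boundary point \<open>\<sigma>\<close>.\<close>

lemma translation_operator_funpow:
  fixes \<sigma> s :: real
  assumes s: "\<bar>s\<bar> < 1" and sign: "0 \<le> \<sigma> * s" and \<sigma>: "\<sigma> = 1 \<or> \<sigma> = - 1"
  shows "\<exists>t. \<bar>t\<bar> < 1 \<and> 0 \<le> \<sigma> * t \<and> (\<forall>f. (translation_operator s ^^ n) f = translation_operator t f)"
proof (induction n)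
  case 0
  have "translation_operator 0 f = f" for f
    by (rule bergman_eqI) (simp add: Rep_translation_operator disk_translation_def del: mem_ball mem_ball_0)
  then show ?case by (intro exI[of _ 0]) simp
next
  case (Suc n)
  then obtain t where t: "\<bar>t\<bar> < 1" "0 \<le> \<sigma> * t"
    and eq: "\<And>f. (translation_operator s ^^ n) f = translation_operator t f" by blast
  let ?u = "(s + t) / (1 + s * t)"
  have u: "\<bar>?u\<bar> < 1" by (rule velocity_addition_bound(1)[OF s t(1)])
  have "0 \<le> \<sigma> * s + \<sigma> * t" using sign t by simp
  then have "0 \<le> \<sigma> * ?u"
    using velocity_addition_bound(2)[OF s t(1)] by (simp add: distrib_left)
  moreover have "translation_operator s (translation_operator t f) = translation_operator ?u f" for f
    by (rule bergman_eqI)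
       (simp only: Rep_translation_operator[OF s] Rep_translation_operator[OF t(1)]
         Rep_translation_operator[OF u] disk_translation_in_ball[OF s] disk_translation_compose[OF s t(1)])
  ultimately show ?case
    using u by (intro exI[of _ ?u]) (simp add: eq)
qed

lemma norm_le_norm_add_of_real:
  fixes u :: complex
  assumes "0 \<le> Re u" "0 \<le> \<delta>"
  shows "cmod u \<le> cmod (u + of_real \<delta>)" "\<delta> \<le> cmod (u + of_real \<delta>)"
proof -
  show "cmod u \<le> cmod (u + of_real \<delta>)"
    using assms by (auto simp: cmod_def intro!: power_mono)
  show "\<delta> \<le> cmod (u + of_real \<delta>)"
    using assms abs_Re_le_cmod[of "u + of_real \<delta>"] by simp
qed

text \<open>The factors \<open>((1 - \<sigma> z) / (1 + \<delta> - \<sigma> z))\<^sup>2\<close> have modulus at most \<open>1\<close> on the disk, where \<open>1 - \<sigma> z\<close> has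
  positive real part, and tend to \<open>1\<close> pointwise as \<open>\<delta> \<rightarrow> 0\<close>.  Multiplying \<open>f\<close> by them gives the
  approximation, by dominated convergence.\<close>

lemma double_boundary_zero_dense:
  fixes \<sigma> :: real
  assumes \<sigma>: "\<sigma> = 1 \<or> \<sigma> = - 1"
  obtains F G where
    "\<And>(k::nat) z. z \<in> ball 0 1 \<Longrightarrow> Rep_bergman (F k) z = (1 - of_real \<sigma> * z)\<^sup>2 * Rep_bergman (G k) z"
    and "F \<longlonglongrightarrow> f"
proof -
  let ?D = "ball 0 1 :: complex set"
  define \<delta> where "\<delta> k = 1 / real (Suc k)" for k
  have \<delta>: "0 < \<delta> k" for k by (simp add: \<delta>_def)
  define p where "p k z = 1 / (1 - of_real \<sigma> * z + of_real (\<delta> k))\<^sup>2" for k and z :: complex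
  define q where "q k z = (1 - of_real \<sigma> * z)\<^sup>2 * p k z" for k and z :: complex
  have Re: "0 < Re (1 - of_real \<sigma> * z)" if "z \<in> ?D" for z
    using that \<sigma> abs_Re_le_cmod[of z] by auto
  have ne: "1 - of_real \<sigma> * z + of_real (\<delta> k) \<noteq> 0" if "z \<in> ?D" for z k
    using Re[OF that] \<delta>[of k] by (metis add_pos_pos less_irrefl plus_complex.sel(1) Re_complex_of_real zero_complex.sel(1))
  have p_hol: "p k holomorphic_on ?D" for k
    unfolding p_def[abs_def] using ne by (intro holomorphic_intros) auto
  have q_hol: "q k holomorphic_on ?D" for k
    unfolding q_def[abs_def] by (intro holomorphic_intros p_hol)
  have p_bd: "cmod (p k z) \<le> 1 / (\<delta> k)\<^sup>2" if "z \<in> ?D" for k z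
    unfolding p_def norm_divide norm_power norm_one
    using norm_le_norm_add_of_real(2)[OF less_imp_le[OF Re[OF that]] less_imp_le[OF \<delta>]] \<delta>[of k] ne[OF that, of k]
    by (intro divide_left_mono power_mono mult_pos_pos zero_less_power) auto
  have q_bd: "cmod (q k z) \<le> 1" if "z \<in> ?D" for k z
  proof -
    have "(cmod (1 - of_real \<sigma> * z))\<^sup>2 \<le> (cmod (1 - of_real \<sigma> * z + of_real (\<delta> k)))\<^sup>2"
      using norm_le_norm_add_of_real(1)[OF less_imp_le[OF Re[OF that]] less_imp_le[OF \<delta>]]
      by (intro power_mono) auto
    then show ?thesis
      using ne[OF that, of k] by (simp add: q_def p_def norm_divide norm_power norm_mult divide_le_eq)
  qed
  have q_lim: "(\<lambda>k. q k z) \<longlonglongrightarrow> 1" if "z \<in> ?D" for z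
  proof -
    have nz: "1 - of_real \<sigma> * z \<noteq> 0" using Re[OF that] by (metis less_irrefl zero_complex.sel(1))
    have "\<delta> \<longlonglongrightarrow> 0" unfolding \<delta>_def using LIMSEQ_inverse_real_of_nat by (simp add: inverse_eq_divide)
    then have "(\<lambda>k. q k z) \<longlonglongrightarrow> (1 - of_real \<sigma> * z)\<^sup>2 * (1 / (1 - of_real \<sigma> * z + of_real 0)\<^sup>2)"
      unfolding q_def p_def using nz by (intro tendsto_intros) simp_all
    then show ?thesis using nz by simp
  qed
  define F where "F k = multiplication_operator (q k) f" for k
  define G where "G k = multiplication_operator (p k) f" for k
  have RepF: "Rep_bergman (F k) z = q k z * Rep_bergman f z" if "z \<in> ?D" for k z
    unfolding F_def using q_hol q_bd that by (rule Rep_multiplication_operator)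
  have RepG: "Rep_bergman (G k) z = p k z * Rep_bergman f z" if "z \<in> ?D" for k z
    unfolding G_def using p_hol p_bd that by (rule Rep_multiplication_operator)
  have "F \<longlonglongrightarrow> f"
  proof -
    let ?d = "\<lambda>k z. indicator ?D z *\<^sub>R (cmod (Rep_bergman (F k - f) z))\<^sup>2"
    have meas: "?d k \<in> borel_measurable lborel" for k
      using Rep_bergman_square_integrable[of "F k - f"] by (simp add: set_integrable_def)
    have "(\<lambda>k. LINT z|lborel. ?d k z) \<longlonglongrightarrow> (LINT z|(lborel :: complex measure). (0 :: real))"
    proof (rule integral_dominated_convergence)
      show "integrable lborel (\<lambda>z. indicator ?D z *\<^sub>R (4 * (cmod (Rep_bergman f z))\<^sup>2))"
        using set_integrable_mult_right[OF Rep_bergman_square_integrable]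
        by (simp add: set_integrable_def)
      have lim: "(\<lambda>k. ?d k z) \<longlonglongrightarrow> 0" for z
      proof (cases "z \<in> ?D")
        case True
        have "(\<lambda>k. (cmod (q k z * Rep_bergman f z - Rep_bergman f z))\<^sup>2)
            \<longlonglongrightarrow> (cmod (1 * Rep_bergman f z - Rep_bergman f z))\<^sup>2"
          by (intro tendsto_intros q_lim True)
        then show ?thesis using True by (simp add: minus_bergman.rep_eq RepF del: mem_ball mem_ball_0)
      qed simp
      then show "AE z in lborel. (\<lambda>k. ?d k z) \<longlonglongrightarrow> 0" by simp
      have bd: "norm (?d k z) \<le> indicator ?D z *\<^sub>R (4 * (cmod (Rep_bergman f z))\<^sup>2)" for k z
      proof (cases "z \<in> ?D")
        case True
        have "cmod (q k z - 1) \<le> 2" using norm_triangle_ineq4[of "q k z" 1] q_bd[OF True, of k] by simp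
        moreover have "Rep_bergman (F k - f) z = (q k z - 1) * Rep_bergman f z"
          by (simp add: minus_bergman.rep_eq RepF[OF True] left_diff_distrib)
        ultimately have "cmod (Rep_bergman (F k - f) z) \<le> 2 * cmod (Rep_bergman f z)"
          by (simp only: norm_mult mult_right_mono norm_ge_zero)
        from power_mono[OF this norm_ge_zero, of 2] show ?thesis
          using True by (simp add: power_mult_distrib)
      qed simp
      then show "AE z in lborel. norm (?d k z) \<le> indicator ?D z *\<^sub>R (4 * (cmod (Rep_bergman f z))\<^sup>2)" for k
        by simp
    qed (rule borel_measurable_const meas)+
    then have "(\<lambda>k. LINT z:?D|lborel. (cmod (Rep_bergman (F k - f) z))\<^sup>2) \<longlonglongrightarrow> 0"
      by (simp add: set_lebesgue_integral_def)
    then have "(\<lambda>k. norm (F k - f)) \<longlonglongrightarrow> sqrt (1 / pi * 0)"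
      unfolding norm_bergman_eq by (intro tendsto_intros)
    then have "(\<lambda>k. F k - f) \<longlonglongrightarrow> 0" by (simp add: tendsto_norm_zero_iff)
    then show ?thesis using LIM_zero_iff by blast
  qed
  then show thesis
    using that[of F G] by (simp add: RepF RepG q_def del: mem_ball mem_ball_0)
qed

lemma translation_operator_scaleC:
  assumes "\<bar>s\<bar> < 1"
  shows "translation_operator s (c *\<^sub>C f) = c *\<^sub>C translation_operator s f"
  by (rule bergman_eqI)
     (simp only: scaleC_bergman.rep_eq Rep_translation_operator[OF assms] disk_translation_in_ball[OF assms])

text \<open>Let \<open>f\<close> have a double zero at \<open>\<sigma>\<close> and let \<open>t\<close> be the parameter of the \<open>n\<close>-th power of the translation.
  In \<open>C\<^sup>n X f = \<mu>\<^sup>n X C\<^sup>n f\<close> the left side is at least of order \<open>(1 - t\<^sup>2) \<parallel>X f\<parallel>\<close>, the right side at most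
  of order \<open>\<bar>\<mu>\<bar>\<^sup>n (1 - t\<^sup>2)\<close>.  The factor \<open>1 - t\<^sup>2\<close> cancels, and \<open>n \<rightarrow> \<infinity>\<close> gives \<open>X f = 0\<close>.
  Such \<open>f\<close> are dense and \<open>X\<close> is continuous.\<close>

lemma contracting_intertwiner_zero:
  fixes \<sigma> s :: real
  assumes s: "\<bar>s\<bar> < 1" and sign: "0 \<le> \<sigma> * s" and \<sigma>: "\<sigma> = 1 \<or> \<sigma> = - 1"
    and X: "bounded_linear X"
    and inter: "\<And>f. translation_operator s (X f) = \<mu> *\<^sub>C X (translation_operator s f)"
    and \<mu>: "cmod \<mu> < 1"
  shows "X f = 0"
proof -
  let ?C = "translation_operator s"
  have powers: "(?C ^^ n) (X f) = \<mu> ^ n *\<^sub>C X ((?C ^^ n) f)" for n f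
  proof (induction n)
    case 0
    then show ?case using scaleC_of_real[of 1 "X f"] by simp
  next
    case (Suc n)
    then show ?case
      by (simp add: translation_operator_scaleC[OF s] inter scaleC_scaleC mult.commute)
  qed
  obtain B where B: "0 \<le> B" "\<And>f. norm (X f) \<le> norm f * B"
    using bounded_linear.nonneg_bounded[OF X] by blast
  have zero: "X f = 0"
    if f: "\<And>z. z \<in> ball 0 1 \<Longrightarrow> Rep_bergman f z = (1 - of_real \<sigma> * z)\<^sup>2 * Rep_bergman g z" for f g
  proof -
    have le: "norm (X f) \<le> cmod \<mu> ^ n * (16 * norm g * B)" for n
    proof -
      obtain t where t: "\<bar>t\<bar> < 1" "0 \<le> \<sigma> * t"
        and eq: "\<And>f. (?C ^^ n) f = translation_operator t f"
        using translation_operator_funpow[OF s sign \<sigma>] by blast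
      have t2: "0 < 1 - t\<^sup>2" using t by (simp add: abs_square_less_1)
      have "(1 - t\<^sup>2) / 4 * norm (X f) \<le> norm (translation_operator t (X f))"
        by (rule norm_translation_operator_lower[OF t(1)])
      also have "\<dots> = cmod \<mu> ^ n * norm (X (translation_operator t f))"
        using powers[of n f] by (simp add: eq norm_scaleC norm_power)
      also have "\<dots> \<le> cmod \<mu> ^ n * (norm (translation_operator t f) * B)"
        by (intro mult_left_mono B) simp
      also have "\<dots> \<le> cmod \<mu> ^ n * (4 * (1 - t\<^sup>2) * norm g * B)"
        using norm_translation_operator_upper[OF t(1) \<sigma> t(2) f] B(1)
        by (intro mult_left_mono mult_right_mono) auto
      finally have "(1 - t\<^sup>2) / 4 * norm (X f) \<le> cmod \<mu> ^ n * (4 * (1 - t\<^sup>2) * norm g * B)" .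
      moreover have "e * N \<le> e * (M * (16 * G * B))" if "e / 4 * N \<le> M * (4 * e * G * B)" for e N M G :: real
        using that by (simp add: algebra_simps)
      ultimately have "(1 - t\<^sup>2) * norm (X f) \<le> (1 - t\<^sup>2) * (cmod \<mu> ^ n * (16 * norm g * B))"
        by blast
      then show ?thesis using t2 by (simp only: mult_le_cancel_left_pos)
    qed
    have "(\<lambda>n. cmod \<mu> ^ n * (16 * norm g * B)) \<longlonglongrightarrow> 0 * (16 * norm g * B)"
      using \<mu> by (intro tendsto_intros LIMSEQ_power_zero) simp
    then have "norm (X f) \<le> 0 * (16 * norm g * B)"
      by (rule LIMSEQ_le_const) (use le in auto)
    then show ?thesis by simp
  qed
  obtain F G where FG: "\<And>(k::nat) z. z \<in> ball 0 1 \<Longrightarrow> Rep_bergman (F k) z = (1 - of_real \<sigma> * z)\<^sup>2 * Rep_bergman (G k) z"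
    and lim: "F \<longlonglongrightarrow> f"
    using double_boundary_zero_dense[OF \<sigma>] by blast
  have "(\<lambda>k. X (F k)) \<longlonglongrightarrow> X f"
    by (rule bounded_linear.tendsto[OF X lim])
  moreover have "X (F k) = 0" for k
    using FG by (rule zero)
  ultimately show "X f = 0"
    by (simp add: LIMSEQ_const_iff)
qed

section \<open>Extended eigenvalues on and off the unit circle\<close>

text \<open>The function \<open>((1 + z) / (1 - z)) powr (\<i> \<tau>)\<close> on the disk.  The Cayley transform
  \<open>(1 + z) / (1 - z)\<close> conjugates translations of the disk to dilations of the right half-plane, and
  purely imaginary powers are bounded there.\<close>

definition cayley_power :: "real \<Rightarrow> complex \<Rightarrow> complex" where
  "cayley_power \<tau> z = exp (\<i> * of_real \<tau> * Ln ((1 + z) / (1 - z)))"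

lemma Cayley_half_plane:
  assumes "z \<in> ball 0 1" shows "0 < Re ((1 + z) / (1 - z))"
proof -
  have n: "(Re z)\<^sup>2 + (Im z)\<^sup>2 < 1"
    using assms by (simp add: cmod_def real_less_lsqrt)
  then have "Re z \<noteq> 1"
    by (metis add_increasing2 less_irrefl not_less one_power2 order_refl zero_le_power2)
  then have "0 < (1 - Re z)\<^sup>2 + (Im z)\<^sup>2" by (simp add: add_pos_nonneg)
  with n show ?thesis
    by (simp add: Re_divide power2_eq_square algebra_simps zero_less_divide_iff)
qed

lemma cayley_power_holomorphic: "cayley_power \<tau> holomorphic_on ball 0 1"
proof -
  have "1 - z \<noteq> 0" if "z \<in> ball 0 1" for z :: complex using that by auto
  moreover have "(1 + z) / (1 - z) \<notin> \<real>\<^sub>\<le>\<^sub>0" if "z \<in> ball 0 1" for z :: complex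
    using Cayley_half_plane[OF that] by (auto simp: complex_nonpos_Reals_iff)
  ultimately show ?thesis
    unfolding cayley_power_def[abs_def] by (intro holomorphic_intros) auto
qed

lemma cayley_power_bounded:
  assumes "z \<in> ball 0 1" shows "cmod (cayley_power \<tau> z) \<le> exp (\<bar>\<tau>\<bar> * pi)"
proof -
  let ?w = "(1 + z) / (1 - z)"
  have "?w \<noteq> 0" using Cayley_half_plane[OF assms] by (metis less_irrefl zero_complex.sel(1))
  then have "\<bar>Im (Ln ?w)\<bar> \<le> pi"
    using Im_Ln_le_pi[of ?w] mpi_less_Im_Ln[of ?w] by linarith
  then have "\<bar>\<tau> * Im (Ln ?w)\<bar> \<le> \<bar>\<tau>\<bar> * pi"
    by (simp add: abs_mult mult_left_mono)
  then have "- (\<tau> * Im (Ln ?w)) \<le> \<bar>\<tau>\<bar> * pi" by linarith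
  then show ?thesis by (simp add: cayley_power_def norm_exp_eq_Re)
qed

text \<open>A dilation by \<open>K > 0\<close> shifts the logarithm by the real number \<open>ln K\<close>.\<close>

lemma cayley_power_translation:
  assumes s: "\<bar>s\<bar> < 1" and z: "z \<in> ball 0 1"
  shows "cayley_power \<tau> (disk_translation s z)
    = exp (\<i> * of_real (\<tau> * ln ((1 + s) / (1 - s)))) * cayley_power \<tau> z"
proof -
  let ?w = "(1 + z) / (1 - z)" and ?K = "(1 + s) / (1 - s)"
  have K: "0 < ?K" using s by simp
  have w: "?w \<noteq> 0" using Cayley_half_plane[OF z] by (metis less_irrefl zero_complex.sel(1))
  have ne: "1 - z \<noteq> 0" "1 - complex_of_real s \<noteq> 0" "1 + of_real s * z \<noteq> 0"
    using z s disk_translation_denominator(2)[OF s z] by auto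
  have "1 + disk_translation s z = (1 + of_real s) * (1 + z) / (1 + of_real s * z)"
    "1 - disk_translation s z = (1 - of_real s) * (1 - z) / (1 + of_real s * z)"
    using ne(3) by (simp_all add: disk_translation_def divide_simps) (simp_all add: algebra_simps)
  then have "(1 + disk_translation s z) / (1 - disk_translation s z) = of_real ?K * ?w"
    using ne by simp
  moreover have "Ln (of_real ?K * ?w) = of_real (ln ?K) + Ln ?w"
    using Ln_times_of_real[OF K w] by (simp only: Ln_of_real[OF K])
  ultimately show ?thesis
    by (simp add: cayley_power_def distrib_left exp_add mult.assoc)
qed

lemma ext_eigenvalue_of_unimodular:
  assumes s: "0 < s" "s < 1" and \<mu>: "cmod \<mu> = 1"
  shows "\<mu> \<in> ext_eigenvalues (translation_operator s)"
proof -
  have s': "\<bar>s\<bar> < 1" using s by simp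
  define L where "L = ln ((1 + s) / (1 - s))"
  have L: "L > 0" using s unfolding L_def by (intro ln_gt_zero) simp
  \<comment> \<open>The exponent for which the translation multiplies the power by \<open>exp (\<i> \<tau> L) = \<mu>\<close>.\<close>
  define \<tau> where "\<tau> = Arg \<mu> / L"
  define h where "h = cayley_power \<tau>"
  have bd: "\<And>z. z \<in> ball 0 1 \<Longrightarrow> cmod (h z) \<le> exp (\<bar>\<tau>\<bar> * pi)"
    unfolding h_def by (rule cayley_power_bounded)
  have hol: "h holomorphic_on ball 0 1"
    unfolding h_def by (rule cayley_power_holomorphic)
  note rep = Rep_multiplication_operator[OF hol bd]
  have "exp (\<i> * of_real (\<tau> * L)) = \<mu>"
    using L \<mu> Arg_eq[of \<mu>] by (force simp: \<tau>_def)
  then have h: "h (disk_translation s z) = \<mu> * h z" if "z \<in> ball 0 1" for z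
    unfolding h_def L_def using cayley_power_translation[OF s' that] by simp
  let ?X = "multiplication_operator h"
  have "translation_operator s (?X f) = \<mu> *\<^sub>C ?X (translation_operator s f)" for f
    by (rule bergman_eqI)
       (simp add: scaleC_bergman.rep_eq Rep_translation_operator[OF s'] rep
         disk_translation_in_ball[OF s'] h del: mem_ball mem_ball_0)
  moreover have "?X \<noteq> (\<lambda>f. 0)"
  proof
    assume eq: "?X = (\<lambda>f. 0)"
    have "(\<lambda>z. if z \<in> ball 0 1 then 1 else 0) \<in> bergman_functions"
      by (rule bergman_functionsI)
         (auto simp: set_integrable_def intro!: integrable_real_indicator emeasure_bounded_finite)
    then obtain f where "Rep_bergman f = (\<lambda>z. if z \<in> ball 0 1 then 1 else 0)"
      by (metis Abs_bergman_inverse)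
    then have "Rep_bergman (?X f) 0 = h 0" using Rep_multiplication_operator[OF hol bd, of 0 f] by simp
    then show False using eq by (simp add: zero_bergman.rep_eq h_def cayley_power_def)
  qed
  ultimately show ?thesis
    unfolding ext_eigenvalues_def
    using bounded_clinear_multiplication_operator[OF hol bd] by blast
qed

text \<open>If \<open>\<bar>\<mu>\<bar> > 1\<close>, the inverse translation intertwines with factor \<open>1 / \<mu>\<close> and moves points towards \<open>- 1\<close>,
  so both cases reduce to a contracting factor.\<close>

lemma ext_eigenvalue_imp_unimodular:
  assumes s: "0 < s" "s < 1" and \<mu>: "\<mu> \<in> ext_eigenvalues (translation_operator s)"
  shows "cmod \<mu> = 1"
proof -
  have s': "\<bar>s\<bar> < 1" "\<bar>- s\<bar> < 1" using s by auto
  let ?C = "translation_operator s" and ?D = "translation_operator (- s)"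
  obtain X where X: "bounded_clinear X" and nz: "X \<noteq> (\<lambda>f. 0)"
    and inter: "\<And>f. ?C (X f) = \<mu> *\<^sub>C X (?C f)"
    using \<mu> by (auto simp: ext_eigenvalues_def)
  have lin: "bounded_linear X" using X by (simp add: bounded_clinear_def)
  have DC: "?D (?C f) = f" and CD: "?C (?D f) = f" for f
    using disk_translation_inverse[OF s'(1)] disk_translation_inverse[OF s'(2)]
    by (auto intro!: bergman_eqI simp only: Rep_translation_operator[OF s'(1)]
        Rep_translation_operator[OF s'(2)] disk_translation_in_ball[OF s'(1)]
        disk_translation_in_ball[OF s'(2)] minus_minus)
  have "\<not> cmod \<mu> < 1"
  proof
    assume "cmod \<mu> < 1"
    then have "X f = 0" for f
      using s(1) by (intro contracting_intertwiner_zero[of s 1, OF s'(1) _ _ lin inter]) simp_all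
    then show False using nz by blast
  qed
  moreover have "\<not> 1 < cmod \<mu>"
  proof
    assume gt: "1 < cmod \<mu>"
    then have "\<mu> \<noteq> 0" by auto
    have "?D (X f) = inverse \<mu> *\<^sub>C X (?D f)" for f
    proof -
      have "X (?D f) = \<mu> *\<^sub>C ?D (X f)"
        using arg_cong[OF inter[of "?D f"], of ?D]
        by (simp add: DC CD translation_operator_scaleC[OF s'(2)])
      then show ?thesis
        using \<open>\<mu> \<noteq> 0\<close> scaleC_of_real[of 1 "?D (X f)"] by (simp add: scaleC_scaleC)
    qed
    moreover have "cmod (inverse \<mu>) < 1" using gt by (simp add: norm_inverse inverse_less_1_iff)
    ultimately have "X f = 0" for f
      using s(1) by (intro contracting_intertwiner_zero[of "- s" "- 1", OF s'(2) _ _ lin]) simp_all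
    then show False using nz by blast
  qed
  ultimately show ?thesis by linarith
qed

theorem theorem4p10:
  fixes r :: real and \<phi> :: "complex \<Rightarrow> complex"
  assumes "0 < r" and "r < 1"
    and "\<And>z. z \<in> ball 0 1 \<Longrightarrow> \<phi> z = (z + of_real r) / (1 + of_real r * z)"
  shows "ext_eigenvalues (composition_operator \<phi>) = {\<mu>. cmod \<mu> = 1}"
proof -
  have "(\<lambda>z. if z \<in> ball 0 1 then Rep_bergman f (\<phi> z) else 0)
      = (\<lambda>z. if z \<in> ball 0 1 then Rep_bergman f (disk_translation r z) else 0)" for f
    using assms(3) by (auto simp: disk_translation_def)
  then have "composition_operator \<phi> = translation_operator r"
    unfolding translation_operator_def composition_operator_def by simp
  then show ?thesis
    using ext_eigenvalue_of_unimodular[OF assms(1,2)] ext_eigenvalue_imp_unimodular[OF assms(1,2)] by auto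
qed

end
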